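(* Fix $1<p<\infty$ and $\theta>0$. Let $(X,d,\mu)$ be a doubling metric measure space that satisfies the weak maximality property for $B^\theta_{p,\infty}(X)$, i.e. there is a constant $C\ge1$ such that $\|u\|_{B^\theta_{p,\infty}(X)}\le C\,\|u\|_{KS^\theta_p(X)}$ for each $u\in B^\theta_{p,\infty}(X)$. Then the dimension of $B^\theta_{p,p}(X)$ is at most $1$, and $\theta_p(X)\le\theta$.
   Context: Throughout, $(X,d)$ is a separable metric space with infinitely many points and $\mu$ is a Borel measure on $X$ with $0<\mu(B(x,r))<\infty$ for all $x\in X$, $r>0$, where $B(x,r)=\{y\in X: d(x,y)<r\}$. The space $(X,d,\mu)$ is a doubling metric measure space if there is a constant $C_{\mathrm D}$ such that $0<\mu(B(x,2r))\le C_{\mathrm D}\,\mu(B(x,r))<\infty$ for all $x\in X$, $r>0$. Functions are identified when they agree $\mu$-a.e. For $u\in L^p(X)$ and $\theta>0$ set $$\|u\|_{B^\theta_{p,p}(X)}^p:=\int_X\int_X\frac{|u(y)-u(x)|^p}{d(x,y)^{\theta p}\,\mu(B(x,d(x,y)))}\,d\mu(y)\,d\mu(x)$$ (the integrand is taken to be $0$ when $x=y$), $$\|u\|_{B^\theta_{p,\infty}(X)}^p:=\sup_{t>0}\int_X\frac{1}{\mu(B(x,t))}\int_{B(x,t)}\frac{|u(y)-u(x)|^p}{t^{\theta p}}\,d\mu(y)\,d\mu(x),$$ and $\|u\|_{KS^\theta_p(X)}^p$ is the same expression as the last one with $\sup_{t>0}$ replaced by $\limsup_{t\to0^+}$. The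 spaces $B^\theta_{p,p}(X)$, $B^\theta_{p,\infty}(X)$, $KS^\theta_p(X)$ consist of those $u\in L^p(X)$ for which the respective quantity is finite. The critical exponent is $\theta_p(X):=\sup\{\theta>0: B^\theta_{p,p}(X)\text{ contains non-constant functions}\}$. *)

theory Defs
  imports "HOL-Analysis.Analysis"
begin

definition doubling :: "'a::metric_space measure \<Rightarrow> bool" where
  "doubling M \<longleftrightarrow> (\<exists>C::real. \<forall>x. \<forall>r>0.
     0 < emeasure M (ball x (2 * r)) \<and>
     emeasure M (ball x (2 * r)) \<le> ennreal C * emeasure M (ball x r) \<and>
     ennreal C * emeasure M (ball x r) < \<infinity>)"

(* Elements of the function spaces are representatives; identification of functions that agree
   almost everywhere is built into ae_constant and ae_dim below. *)
definition Lp_space :: "'a measure \<Rightarrow> real \<Rightarrow> ('a \<Rightarrow> real) set" where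
  "Lp_space M p = {u \<in> borel_measurable M. (\<integral>\<^sup>+x. ennreal (\<bar>u x\<bar> powr p) \<partial>M) < \<infinity>}"

(* Used only with exponent a > 0. *)
definition ennreal_powr :: "ennreal \<Rightarrow> real \<Rightarrow> ennreal" where
  "ennreal_powr x a = (if x = \<infinity> then \<infinity> else ennreal (enn2real x powr a))"

(* The three energies are the p-th powers of the corresponding seminorms. *)
definition besov_pp_energy :: "'a::metric_space measure \<Rightarrow> real \<Rightarrow> real \<Rightarrow> ('a \<Rightarrow> real) \<Rightarrow> ennreal" where
  "besov_pp_energy M p \<theta> u =
     (\<integral>\<^sup>+x. (\<integral>\<^sup>+y. (if x = y then 0
        else ennreal (\<bar>u y - u x\<bar> powr p / dist x y powr (\<theta> * p)) / emeasure M (ball x (dist x y)))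
      \<partial>M) \<partial>M)"

definition scale_energy ::
    "'a::metric_space measure \<Rightarrow> real \<Rightarrow> real \<Rightarrow> ('a \<Rightarrow> real) \<Rightarrow> real \<Rightarrow> ennreal" where
  "scale_energy M p \<theta> u t =
     (\<integral>\<^sup>+x. 1 / emeasure M (ball x t) *
        (\<integral>\<^sup>+y\<in>ball x t. ennreal (\<bar>u y - u x\<bar> powr p / t powr (\<theta> * p)) \<partial>M) \<partial>M)"

definition besov_inf_energy :: "'a::metric_space measure \<Rightarrow> real \<Rightarrow> real \<Rightarrow> ('a \<Rightarrow> real) \<Rightarrow> ennreal" where
  "besov_inf_energy M p \<theta> u = (SUP t\<in>{0<..}. scale_energy M p \<theta> u t)"

definition KS_energy :: "'a::metric_space measure \<Rightarrow> real \<Rightarrow> real \<Rightarrow> ('a \<Rightarrow> real) \<Rightarrow> ennreal" where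
  "KS_energy M p \<theta> u = Limsup (at_right 0) (scale_energy M p \<theta> u)"

definition besov_inf_norm :: "'a::metric_space measure \<Rightarrow> real \<Rightarrow> real \<Rightarrow> ('a \<Rightarrow> real) \<Rightarrow> ennreal" where
  "besov_inf_norm M p \<theta> u = ennreal_powr (besov_inf_energy M p \<theta> u) (1 / p)"

definition KS_norm :: "'a::metric_space measure \<Rightarrow> real \<Rightarrow> real \<Rightarrow> ('a \<Rightarrow> real) \<Rightarrow> ennreal" where
  "KS_norm M p \<theta> u = ennreal_powr (KS_energy M p \<theta> u) (1 / p)"

definition besov_pp :: "'a::metric_space measure \<Rightarrow> real \<Rightarrow> real \<Rightarrow> ('a \<Rightarrow> real) set" where
  "besov_pp M p \<theta> = {u \<in> Lp_space M p. besov_pp_energy M p \<theta> u < \<infinity>}"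

definition besov_inf :: "'a::metric_space measure \<Rightarrow> real \<Rightarrow> real \<Rightarrow> ('a \<Rightarrow> real) set" where
  "besov_inf M p \<theta> = {u \<in> Lp_space M p. besov_inf_energy M p \<theta> u < \<infinity>}"

definition weak_maximality :: "'a::metric_space measure \<Rightarrow> real \<Rightarrow> real \<Rightarrow> bool" where
  "weak_maximality M p \<theta> \<longleftrightarrow>
     (\<exists>C\<ge>1::real. \<forall>u\<in>besov_inf M p \<theta>. besov_inf_norm M p \<theta> u \<le> ennreal C * KS_norm M p \<theta> u)"

definition ae_constant :: "'a measure \<Rightarrow> ('a \<Rightarrow> real) \<Rightarrow> bool" where
  "ae_constant M u \<longleftrightarrow> (\<exists>c. AE x in M. u x = c)"

(* Since the set in question consists of positive reals, its supremum is taken in [0, infinity]. *)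
definition critical_exponent :: "'a::metric_space measure \<Rightarrow> real \<Rightarrow> ennreal" where
  "critical_exponent M p =
     Sup {ennreal \<theta> |\<theta>. 0 < \<theta> \<and> (\<exists>u\<in>besov_pp M p \<theta>. \<not> ae_constant M u)}"

(* Linear independence of the equivalence classes of the elements of the finite set S; two distinct
   representatives of the same class are dependent, as their difference vanishes a.e. *)
definition ae_independent :: "'a measure \<Rightarrow> ('a \<Rightarrow> real) set \<Rightarrow> bool" where
  "ae_independent M S \<longleftrightarrow>
     (\<forall>c. (AE x in M. (\<Sum>u\<in>S. c u * u x) = 0) \<longrightarrow> (\<forall>u\<in>S. c u = 0))"

(* Dimension (possibly infinite) of the real vector space of equivalence classes of elements of V,
   as the supremum of the cardinalities of finite linearly independent sets. *)
definition ae_dim :: "'a measure \<Rightarrow> ('a \<Rightarrow> real) set \<Rightarrow> enat" where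
  "ae_dim M V = (SUP S\<in>{S. finite S \<and> S \<subseteq> V \<and> ae_independent M S}. enat (card S))"

end

theory Submission
  imports Defs
begin

text \<open>For points at distance less than t the weights of the \<open>B\<^sub>p\<^sub>,\<^sub>p\<close>-kernel dominate those of the energy at scale t, so
  the latter is at most the part of the \<open>B\<^sub>p\<^sub>,\<^sub>p\<close>-energy coming from pairs at distance less than t. Hence
  it is bounded, and tends to 0 with t by dominated convergence. Lowering the exponent only helps for
  \<open>t \<le> 1\<close>, while for \<open>t > 1\<close> doubling bounds the energy by the \<open>L\<^sup>p\<close>-norm. So every function in
  \<open>B\<^sub>p\<^sub>,\<^sub>p\<close> of exponent at least \<open>\<theta>\<close> lies in the domain of the weak maximality property and has vanishing
  \<open>KS\<close>-energy; all its scale energies then vanish, and it is constant almost everywhere.\<close>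

section \<open>Elementary inequalities\<close>

lemma ennreal_inverse_antimono: "x \<le> y \<Longrightarrow> inverse y \<le> inverse (x::ennreal)"
  including ennreal.lifting by transfer (rule ereal_inverse_antimono)

lemma powr_abs_diff_le:
  fixes a b p :: real
  assumes "0 < p"
  shows "\<bar>a - b\<bar> powr p \<le> 2 powr p * (\<bar>a\<bar> powr p + \<bar>b\<bar> powr p)"
proof -
  have "\<bar>a - b\<bar> powr p \<le> (2 * max \<bar>a\<bar> \<bar>b\<bar>) powr p"
    using assms by (intro powr_mono2) auto
  also have "\<dots> = 2 powr p * max \<bar>a\<bar> \<bar>b\<bar> powr p"
    by (simp add: powr_mult)
  also have "\<dots> \<le> 2 powr p * (\<bar>a\<bar> powr p + \<bar>b\<bar> powr p)"
    by (intro mult_left_mono) (auto simp: max_def)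
  finally show ?thesis .
qed

section \<open>Measurability of distances and ball volumes\<close>

locale ball_finite_measure =
  fixes M :: "'a::{metric_space, second_countable_topology} measure"
  assumes sets_M: "sets M = sets borel"
    and ball_pos: "0 < r \<Longrightarrow> 0 < emeasure M (ball x r)"
    and ball_finite: "0 < r \<Longrightarrow> emeasure M (ball x r) < \<infinity>"
begin

lemma space_M [simp]: "space M = UNIV"
  using sets_eq_imp_space_eq[OF sets_M] by simp

declare sets_M [measurable_cong]

sublocale sigma_finite_measure M
proof
  have "(\<Union>n::nat. ball x (Suc n)) = UNIV" for x :: 'a
  proof -
    have "\<exists>n::nat. dist x y < Suc n" for y
    proof -
      obtain n :: nat where "dist x y < n" using reals_Archimedean2 by blast
      then have "dist x y < Suc n" by simp
      then show ?thesis ..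
    qed
    then show ?thesis by auto
  qed
  then show "\<exists>A. countable A \<and> A \<subseteq> sets M \<and> \<Union> A = space M \<and> (\<forall>a\<in>A. emeasure M a \<noteq> \<infinity>)"
    using ball_finite
    \<comment> \<open>The centre is arbitrary. The radii \<open>Suc n\<close> are positive, as
      \<open>ball_finite\<close> requires.\<close>
    by (intro exI[of _ "range (\<lambda>n::nat. ball undefined (Suc n))"]) (auto simp: sets_M less_top)
qed

sublocale pair: pair_sigma_finite M M ..

text \<open>Separability enters here: second countability makes the Borel sets of the product space
  coincide with the product sigma-algebra, so continuous functions of a pair and open conditions on
  pairs are measurable.\<close>

lemma sets_pair: "sets (M \<Otimes>\<^sub>M M) = sets borel"
  using sets_pair_measure_cong[OF sets_M sets_M] by (simp only: borel_prod)

lemma measurable_dist_pair [measurable]: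
  "(\<lambda>z. dist (fst z) (snd z)) \<in> borel_measurable (M \<Otimes>\<^sub>M M)"
proof -
  have "(\<lambda>z::'a \<times> 'a. dist (fst z) (snd z)) \<in> borel_measurable borel"
    by (intro borel_measurable_continuous_onI continuous_intros)
  then show ?thesis
    by (simp add: measurable_cong_sets[OF sets_pair refl])
qed

lemma sets_dist_less [measurable]:
  "{z. dist (fst z) (snd z) < t} \<in> sets (M \<Otimes>\<^sub>M M)"
  using measurable_sets[OF measurable_dist_pair, of "{..<t}"]
  by (simp add: vimage_def space_pair_measure)

lemma measurable_emeasure_ball [measurable]:
  "(\<lambda>x. emeasure M (ball x t)) \<in> borel_measurable M"
  using measurable_emeasure_Pair[OF sets_dist_less, of t] by (simp add: ball_def vimage_def)

text \<open>The volume is the measure of the section, over the pair, of an open set of triples, so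
  measurability of section measures applies.\<close>

lemma measurable_emeasure_ball_dist [measurable]:
  "(\<lambda>z. emeasure M (ball (fst z) (dist (fst z) (snd z)))) \<in> borel_measurable (M \<Otimes>\<^sub>M M)"
proof -
  let ?Q = "{w::('a \<times> 'a) \<times> 'a. dist (fst (fst w)) (snd w) < dist (fst (fst w)) (snd (fst w))}"
  have "open ?Q"
    by (intro open_Collect_less continuous_intros)
  moreover have "sets ((M \<Otimes>\<^sub>M M) \<Otimes>\<^sub>M M) = sets borel"
    using sets_pair_measure_cong[OF sets_pair sets_M] by (simp only: borel_prod)
  ultimately have "?Q \<in> sets ((M \<Otimes>\<^sub>M M) \<Otimes>\<^sub>M M)"
    by simp
  from measurable_emeasure_Pair[OF this] show ?thesis
    by (simp add: ball_def vimage_def)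
qed

lemma pred_diagonal [measurable]: "Measurable.pred (M \<Otimes>\<^sub>M M) (\<lambda>z. fst z = snd z)"
proof -
  have "Measurable.pred (M \<Otimes>\<^sub>M M) (\<lambda>z. dist (fst z) (snd z) = 0)"
    by measurable
  then show ?thesis by simp
qed

section \<open>The energy near the diagonal\<close>

definition kernel :: "real \<Rightarrow> real \<Rightarrow> ('a \<Rightarrow> real) \<Rightarrow> 'a \<Rightarrow> 'a \<Rightarrow> ennreal" where
  "kernel p s u x y = (if x = y then 0
     else ennreal (\<bar>u y - u x\<bar> powr p / dist x y powr (s * p)) / emeasure M (ball x (dist x y)))"

lemma measurable_kernel [measurable]:
  assumes [measurable]: "u \<in> borel_measurable M"
  shows "(\<lambda>z. kernel p s u (fst z) (snd z)) \<in> borel_measurable (M \<Otimes>\<^sub>M M)"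
  unfolding kernel_def by measurable

definition near_energy :: "real \<Rightarrow> real \<Rightarrow> ('a \<Rightarrow> real) \<Rightarrow> real \<Rightarrow> ennreal" where
  "near_energy p s u t = (\<integral>\<^sup>+x. (\<integral>\<^sup>+y. kernel p s u x y * indicator (ball x t) y \<partial>M) \<partial>M)"

lemma near_energy_le: "near_energy p s u t \<le> besov_pp_energy M p s u"
  unfolding near_energy_def besov_pp_energy_def kernel_def
  by (intro nn_integral_mono) (auto simp: indicator_def)

lemma near_energy_mono: "t \<le> t' \<Longrightarrow> near_energy p s u t \<le> near_energy p s u t'"
  unfolding near_energy_def by (intro nn_integral_mono) (auto simp: indicator_def)

text \<open>The kernel itself is the integrable majorant on the product. Off the diagonal the
  cut-off kernel is eventually 0; on the diagonal the kernel is 0 by convention. Dominated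
  convergence is a statement about sequences, hence the scales \<open>1 / real (Suc n)\<close>;
  \<open>near_energy_mono\<close> covers the scales in between.\<close>

lemma near_energy_tendsto_0:
  assumes [measurable]: "u \<in> borel_measurable M" and fin: "besov_pp_energy M p s u < \<infinity>"
  shows "(\<lambda>n. near_energy p s u (1 / real (Suc n))) \<longlonglongrightarrow> 0"
proof -
  let ?k = "\<lambda>z. kernel p s u (fst z) (snd z)"
  let ?f = "\<lambda>n z. ?k z * indicator {z. dist (fst z) (snd z) < 1 / real (Suc n)} z"
  have m [measurable]: "?f n \<in> borel_measurable (M \<Otimes>\<^sub>M M)" for n
    by measurable
  have "(\<lambda>n. \<integral>\<^sup>+z. ?f n z \<partial>(M \<Otimes>\<^sub>M M)) \<longlonglongrightarrow> (\<integral>\<^sup>+z. 0 \<partial>(M \<Otimes>\<^sub>M M))"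
  proof (rule nn_integral_dominated_convergence[where w = ?k])
    have "(\<integral>\<^sup>+z. ?k z \<partial>(M \<Otimes>\<^sub>M M)) = besov_pp_energy M p s u"
      unfolding besov_pp_energy_def
      by (subst nn_integral_fst[symmetric]) (auto simp: kernel_def[abs_def])
    then show "(\<integral>\<^sup>+z. ?k z \<partial>(M \<Otimes>\<^sub>M M)) < \<infinity>"
      using fin by simp
    show "AE z in M \<Otimes>\<^sub>M M. (\<lambda>n. ?f n z) \<longlonglongrightarrow> 0"
    proof (rule AE_I2)
      fix z :: "'a \<times> 'a"
      show "(\<lambda>n. ?f n z) \<longlonglongrightarrow> 0"
      proof (cases "fst z = snd z")
        case True
        then show ?thesis by (simp add: kernel_def)
      next
        case False
        then have "0 < dist (fst z) (snd z)" by simp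
        with LIMSEQ_inverse_real_of_nat
        have "\<forall>\<^sub>F n in sequentially. inverse (real (Suc n)) < dist (fst z) (snd z)"
          by (rule order_tendstoD)
        then have "\<forall>\<^sub>F n in sequentially. ?f n z = 0"
          by eventually_elim (auto simp: indicator_def field_simps)
        then show ?thesis by (rule tendsto_eventually)
      qed
    qed
  qed (auto simp: indicator_def)
  moreover have "(\<integral>\<^sup>+z. ?f n z \<partial>(M \<Otimes>\<^sub>M M)) = near_energy p s u (1 / real (Suc n))" for n
    unfolding near_energy_def
    by (subst nn_integral_fst[symmetric, OF m]) (auto simp: indicator_def intro!: nn_integral_cong)
  ultimately show ?thesis by simp
qed

lemma scale_energy_le_near_energy:
  assumes "0 < t" "0 < s" "0 < p" and [measurable]: "u \<in> borel_measurable M"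
  shows "scale_energy M p s u t \<le> near_energy p s u t"
proof -
  have "1 / emeasure M (ball x t) *
      (ennreal (\<bar>u y - u x\<bar> powr p / t powr (s * p)) * indicator (ball x t) y)
    \<le> kernel p s u x y * indicator (ball x t) y" for x y
  proof (cases "x = y \<or> y \<notin> ball x t")
    case True
    \<comment> \<open>On the diagonal the numerator is \<open>0 powr p = 0\<close>, which agrees
      with the convention in \<open>kernel\<close>; outside the ball both indicators vanish.\<close>
    then show ?thesis using assms by (auto simp: kernel_def)
  next
    case False
    then have d: "0 < dist x y" "dist x y < t" by auto
    have "\<bar>u y - u x\<bar> powr p / t powr (s * p) \<le> \<bar>u y - u x\<bar> powr p / dist x y powr (s * p)"
      using d assms by (intro divide_left_mono powr_mono2) auto
    moreover have "1 / emeasure M (ball x t) \<le> 1 / emeasure M (ball x (dist x y))"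
      using d unfolding divide_ennreal_def
      by (intro mult_left_mono ennreal_inverse_antimono emeasure_mono) (auto simp: sets_M)
    ultimately have "1 / emeasure M (ball x t) * ennreal (\<bar>u y - u x\<bar> powr p / t powr (s * p))
      \<le> 1 / emeasure M (ball x (dist x y)) * ennreal (\<bar>u y - u x\<bar> powr p / dist x y powr (s * p))"
      by (intro mult_mono ennreal_leI) auto
    then show ?thesis
      using False by (simp add: kernel_def divide_ennreal_def mult.commute)
  qed
  then have le: "(\<integral>\<^sup>+y. 1 / emeasure M (ball x t) *
      (ennreal (\<bar>u y - u x\<bar> powr p / t powr (s * p)) * indicator (ball x t) y) \<partial>M)
    \<le> (\<integral>\<^sup>+y. kernel p s u x y * indicator (ball x t) y \<partial>M)" for x
    by (intro nn_integral_mono)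
  have [measurable]: "ball x t \<in> sets M" for x by (simp add: sets_M)
  have "1 / emeasure M (ball x t) * (\<integral>\<^sup>+y\<in>ball x t. ennreal (\<bar>u y - u x\<bar> powr p / t powr (s * p)) \<partial>M)
    \<le> (\<integral>\<^sup>+y. kernel p s u x y * indicator (ball x t) y \<partial>M)" for x
    by (rule order_trans[OF eq_refl[OF nn_integral_cmult[symmetric]] le]) measurable
  then show ?thesis
    unfolding scale_energy_def near_energy_def by (intro nn_integral_mono)
qed

section \<open>Lower exponents at small scales, the L^p bound at large scales\<close>

lemma scale_energy_exponent_mono:
  assumes "0 < t" "t \<le> 1" "0 < p" "r \<le> s"
  shows "scale_energy M p r u t \<le> scale_energy M p s u t"
proof -
  have "t powr (s * p) \<le> t powr (r * p)"
    using assms by (intro powr_mono') auto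
  then have "\<bar>u y - u x\<bar> powr p / t powr (r * p) \<le> \<bar>u y - u x\<bar> powr p / t powr (s * p)" for x y
    using assms by (intro divide_left_mono) auto
  then show ?thesis
    unfolding scale_energy_def
    by (intro nn_integral_mono mult_left_mono mult_right_mono ennreal_leI) auto
qed

text \<open>Averaging kernels have mass 1 in y; this controls their mass in the centre x. If y lies
  in \<open>ball x t\<close>, then \<open>ball y t\<close> is contained in
  \<open>ball x (2 * t)\<close>, so doubling replaces 1 / mu(B(x,t)) by C / mu(B(y,t)), which is
  constant in x. The admissible x are exactly those in \<open>ball y t\<close>.\<close>

lemma nn_integral_inverse_ball_le:
  assumes "0 < t"
    and dbl: "\<And>x. emeasure M (ball x (2 * t)) \<le> ennreal C * emeasure M (ball x t)"
  shows "(\<integral>\<^sup>+x. 1 / emeasure M (ball x t) * indicator (ball x t) y \<partial>M) \<le> ennreal C"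
proof -
  let ?m = "emeasure M (ball y t)"
  have m: "0 < ?m" "?m < \<infinity>" using ball_pos ball_finite assms by auto
  have "1 / emeasure M (ball x t) * indicator (ball x t) y \<le> (ennreal C / ?m) * indicator (ball y t) x" for x
  proof (cases "y \<in> ball x t")
    case True
    let ?n = "emeasure M (ball x t)"
    have n: "0 < ?n" "?n < \<infinity>" using ball_pos ball_finite assms by auto
    have "ball y t \<subseteq> ball x (2 * t)"
    proof
      fix z assume "z \<in> ball y t"
      then show "z \<in> ball x (2 * t)"
        using True dist_triangle[of x z y] by simp
    qed
    then have "?m \<le> ennreal C * ?n"
      using dbl[of x] emeasure_mono[of "ball y t" "ball x (2 * t)" M] by (simp add: sets_M)
    \<comment> \<open>Cancellation in \<open>ennreal\<close> is legitimate only for values that are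
      neither 0 nor infinite, so each quotient \<open>?n / ?n\<close> and \<open>?m / ?m\<close> is
      isolated and evaluated by \<open>n\<close> or \<open>m\<close>.\<close>
    then have "?m * (1 / ?n) \<le> ennreal C * ?n * (1 / ?n)"
      by (intro mult_right_mono) auto
    also have "\<dots> = ennreal C * (?n / ?n)"
      by (simp add: divide_ennreal_def mult.assoc)
    also have "\<dots> = ennreal C"
      using n by (simp add: ennreal_divide_self)
    finally have *: "?m * (1 / ?n) \<le> ennreal C" .
    have "1 / ?n = (?m / ?m) * (1 / ?n)"
      using m by (simp add: ennreal_divide_self)
    also have "\<dots> = (?m * (1 / ?n)) / ?m"
      by (simp add: divide_ennreal_def mult_ac)
    also have "\<dots> \<le> ennreal C / ?m"
      by (rule divide_right_mono_ennreal[OF *])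
    finally show ?thesis
      using True by (simp add: dist_commute)
  qed (simp add: dist_commute)
  then have "(\<integral>\<^sup>+x. 1 / emeasure M (ball x t) * indicator (ball x t) y \<partial>M)
      \<le> (\<integral>\<^sup>+x. (ennreal C / ?m) * indicator (ball y t) x \<partial>M)"
    by (intro nn_integral_mono)
  also have "\<dots> = (ennreal C / ?m) * ?m"
    by (simp add: sets_M nn_integral_cmult_indicator)
  also have "\<dots> = ennreal C * (?m / ?m)"
    by (simp add: divide_ennreal_def mult_ac)
  also have "\<dots> = ennreal C"
    using m by (simp add: ennreal_divide_self)
  finally show ?thesis .
qed

text \<open>For t at least 1 the factor t^(-sp) is at most 1, and |u y - u x|^p is at most 2^p (|u
  y|^p + |u x|^p). The term in u x is averaged over y with total weight 1, giving the summand 1 of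
  the constant. The term in u y is treated by exchanging the integrals, and
  \<open>nn_integral_inverse_ball_le\<close> gives the summand C.\<close>

lemma scale_energy_le_Lp:
  assumes t: "1 \<le> t" and s: "0 < s" and p: "0 < p" and [measurable]: "u \<in> borel_measurable M"
    and dbl: "\<And>x. emeasure M (ball x (2 * t)) \<le> ennreal C * emeasure M (ball x t)"
  shows "scale_energy M p s u t
    \<le> ennreal (2 powr p) * (1 + ennreal C) * (\<integral>\<^sup>+x. ennreal (\<bar>u x\<bar> powr p) \<partial>M)"
proof -
  let ?w = "\<lambda>x y. 1 / emeasure M (ball x t) * indicator (ball x t) y :: ennreal"
  let ?U = "\<lambda>x. ennreal (\<bar>u x\<bar> powr p)"
  \<comment> \<open>The ball moves with x, so joint measurability is obtained from the indicator of
    a fixed set of pairs.\<close>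
  have "(\<lambda>z. 1 / emeasure M (ball (fst z) t) * indicator {z. dist (fst z) (snd z) < t} z :: ennreal)
      \<in> borel_measurable (M \<Otimes>\<^sub>M M)"
    by measurable
  then have W [measurable]: "(\<lambda>z. ?w (fst z) (snd z)) \<in> borel_measurable (M \<Otimes>\<^sub>M M)"
    by (simp add: indicator_def)
  have W' [measurable]: "case_prod ?w \<in> borel_measurable (M \<Otimes>\<^sub>M M)"
    using W by (simp add: case_prod_beta')
  have ind [measurable]: "ball x t \<in> sets M" for x by (simp add: sets_M)
  have w_int: "(\<integral>\<^sup>+y. ?w x y \<partial>M) = 1" for x
    using ball_pos[of t x] ball_finite[of t x] t
    by (subst nn_integral_cmult_indicator) (auto simp: ennreal_divide_times ennreal_divide_self)
  have pt: "ennreal (\<bar>u y - u x\<bar> powr p / t powr (s * p)) \<le> ennreal (2 powr p) * (?U y + ?U x)" for x y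
  proof -
    have "\<bar>u y - u x\<bar> powr p / t powr (s * p) \<le> \<bar>u y - u x\<bar> powr p / 1"
      using t s p by (intro divide_left_mono) (auto simp: ge_one_powr_ge_zero)
    also have "\<dots> \<le> 2 powr p * (\<bar>u y\<bar> powr p + \<bar>u x\<bar> powr p)"
      using powr_abs_diff_le[OF p] by simp
    finally show ?thesis
      by (simp add: ennreal_mult'[symmetric] ennreal_plus[symmetric] ennreal_leI del: ennreal_plus)
  qed
  have "(\<integral>\<^sup>+x. (\<integral>\<^sup>+y. ?w x y * ?U y \<partial>M) \<partial>M) = (\<integral>\<^sup>+y. (\<integral>\<^sup>+x. ?w x y * ?U y \<partial>M) \<partial>M)"
    by (rule pair.Fubini'[symmetric]) measurable
  also have "\<dots> = (\<integral>\<^sup>+y. (\<integral>\<^sup>+x. ?w x y \<partial>M) * ?U y \<partial>M)"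
    by (intro nn_integral_cong nn_integral_multc) measurable
  also have "\<dots> \<le> (\<integral>\<^sup>+y. ennreal C * ?U y \<partial>M)"
    using t dbl by (intro nn_integral_mono mult_right_mono nn_integral_inverse_ball_le) auto
  also have "\<dots> = ennreal C * (\<integral>\<^sup>+y. ?U y \<partial>M)"
    by (simp add: nn_integral_cmult)
  finally have swap: "(\<integral>\<^sup>+x. (\<integral>\<^sup>+y. ?w x y * ?U y \<partial>M) \<partial>M) \<le> ennreal C * (\<integral>\<^sup>+y. ?U y \<partial>M)" .
  have "scale_energy M p s u t =
      (\<integral>\<^sup>+x. (\<integral>\<^sup>+y. ?w x y * ennreal (\<bar>u y - u x\<bar> powr p / t powr (s * p)) \<partial>M) \<partial>M)"
    unfolding scale_energy_def
    by (subst nn_integral_cmult[symmetric]) (auto simp: mult_ac)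
  also have "\<dots> \<le> (\<integral>\<^sup>+x. (\<integral>\<^sup>+y. ?w x y * (ennreal (2 powr p) * (?U y + ?U x)) \<partial>M) \<partial>M)"
    by (intro nn_integral_mono mult_left_mono pt) auto
  also have "\<dots> = (\<integral>\<^sup>+x. (\<integral>\<^sup>+y. ennreal (2 powr p) * (?w x y * ?U y) + ennreal (2 powr p) * (?U x * ?w x y) \<partial>M) \<partial>M)"
    by (simp add: algebra_simps)
  also have "\<dots> = (\<integral>\<^sup>+x. (ennreal (2 powr p) * (\<integral>\<^sup>+y. ?w x y * ?U y \<partial>M) + ennreal (2 powr p) * ?U x) \<partial>M)"
    by (subst nn_integral_add) (auto simp: nn_integral_cmult w_int)
  also have "\<dots> = ennreal (2 powr p) * (\<integral>\<^sup>+x. (\<integral>\<^sup>+y. ?w x y * ?U y \<partial>M) \<partial>M)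
      + ennreal (2 powr p) * (\<integral>\<^sup>+x. ?U x \<partial>M)"
    by (subst nn_integral_add) (auto simp: nn_integral_cmult)
  also have "\<dots> \<le> ennreal (2 powr p) * (ennreal C * (\<integral>\<^sup>+x. ?U x \<partial>M))
      + ennreal (2 powr p) * (\<integral>\<^sup>+x. ?U x \<partial>M)"
    by (intro add_right_mono mult_left_mono swap) simp
  finally show ?thesis
    by (simp add: algebra_simps)
qed

section \<open>Vanishing energies and almost everywhere constancy\<close>

lemma besov_pp_imp_KS_zero:
  assumes u: "u \<in> besov_pp M p s" and "0 < p" "0 < r" "r \<le> s"
  shows "KS_energy M p r u = 0"
proof -
  have [measurable]: "u \<in> borel_measurable M" and fin: "besov_pp_energy M p s u < \<infinity>"
    using u by (auto simp: besov_pp_def Lp_space_def)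
  have "KS_energy M p r u \<le> near_energy p s u (1 / real (Suc n))" for n
    unfolding KS_energy_def
  proof (rule Limsup_bounded)
    \<comment> \<open>With n fixed, every such t is also at most 1, so the exponent can be lowered
      from \<open>s\<close> to \<open>r\<close> before comparing with the near-diagonal
      energy.\<close>
    have "\<forall>\<^sub>F t in at_right 0. t \<in> {0<..<1 / real (Suc n)}"
      by (rule eventually_at_right_real) simp
    then show "\<forall>\<^sub>F t in at_right 0. scale_energy M p r u t \<le> near_energy p s u (1 / real (Suc n))"
    proof eventually_elim
      case (elim t)
      then have t: "0 < t" "t \<le> 1 / real (Suc n)" by auto
      moreover have "1 / real (Suc n) \<le> 1" by simp
      ultimately have "t \<le> 1" by linarith
      have "scale_energy M p r u t \<le> scale_energy M p s u t"
        using t \<open>t \<le> 1\<close> assms by (intro scale_energy_exponent_mono) auto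
      also have "\<dots> \<le> near_energy p s u t"
        using t assms by (intro scale_energy_le_near_energy) auto
      also have "\<dots> \<le> near_energy p s u (1 / real (Suc n))"
        by (rule near_energy_mono[OF t(2)])
      finally show ?case .
    qed
  qed
  \<comment> \<open>The limsup does not depend on n, so n may tend to infinity in the bound.\<close>
  then have "KS_energy M p r u \<le> 0"
    by (intro LIMSEQ_le_const[OF near_energy_tendsto_0[OF _ fin]]) auto
  then show ?thesis by simp
qed

lemma besov_pp_subset_besov_inf:
  assumes "doubling M" "0 < p" "0 < r" "r \<le> s"
  shows "besov_pp M p s \<subseteq> besov_inf M p r"
proof
  fix u assume u: "u \<in> besov_pp M p s"
  then have [measurable]: "u \<in> borel_measurable M" and fin: "besov_pp_energy M p s u < \<infinity>"
    and Lp: "u \<in> Lp_space M p" "(\<integral>\<^sup>+x. ennreal (\<bar>u x\<bar> powr p) \<partial>M) < \<infinity>"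
    by (auto simp: besov_pp_def Lp_space_def)
  obtain C where C: "\<And>x r. 0 < r \<Longrightarrow> emeasure M (ball x (2 * r)) \<le> ennreal C * emeasure M (ball x r)"
    using assms(1) unfolding doubling_def by blast
  let ?L = "ennreal (2 powr p) * (1 + ennreal C) * (\<integral>\<^sup>+x. ennreal (\<bar>u x\<bar> powr p) \<partial>M)"
  \<comment> \<open>The maximum of the two bounds is independent of t and hence passes to the
    supremum.\<close>
  have "scale_energy M p r u t \<le> max (besov_pp_energy M p s u) ?L" if "0 < t" for t
  proof (cases "t \<le> 1")
    case True
    have "scale_energy M p r u t \<le> scale_energy M p s u t"
      using that True assms by (intro scale_energy_exponent_mono) auto
    also have "\<dots> \<le> near_energy p s u t"
      using that assms by (intro scale_energy_le_near_energy) auto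
    also have "\<dots> \<le> besov_pp_energy M p s u"
      by (rule near_energy_le)
    finally show ?thesis by (simp add: le_max_iff_disj)
  next
    case False
    then have "scale_energy M p r u t \<le> ?L"
      using assms C by (intro scale_energy_le_Lp) auto
    then show ?thesis by (simp add: le_max_iff_disj)
  qed
  then have "besov_inf_energy M p r u \<le> max (besov_pp_energy M p s u) ?L"
    unfolding besov_inf_energy_def by (intro SUP_least) auto
  also have "\<dots> < \<infinity>"
    using fin Lp(2) by (auto simp: ennreal_mult_less_top)
  finally show "u \<in> besov_inf M p r"
    using Lp by (simp add: besov_inf_def)
qed

text \<open>At each scale t, for almost every x, u equals u x almost everywhere on
  \<open>ball x t\<close>. The exceptional null set of x depends on t, so only positive integer
  radii are used: a countable union of null sets leaves one centre x that is good for all of them,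
  and the balls about it exhaust the space.\<close>

lemma ae_constant_if_scale_energy_zero:
  assumes [measurable]: "u \<in> borel_measurable M" and zero: "\<And>t. 0 < t \<Longrightarrow> scale_energy M p s u t = 0"
  shows "ae_constant M u"
proof -
  have ind [measurable]: "ball x t \<in> sets M" for x t by (simp add: sets_M)
  have ae: "AE x in M. AE y in M. y \<in> ball x t \<longrightarrow> u y = u x" if t: "0 < t" for t
  proof -
    let ?g = "\<lambda>x y. ennreal (\<bar>u y - u x\<bar> powr p / t powr (s * p)) * indicator (ball x t) y"
    have "(\<lambda>z. ennreal (\<bar>u (snd z) - u (fst z)\<bar> powr p / t powr (s * p))
        * indicator {z. dist (fst z) (snd z) < t} z) \<in> borel_measurable (M \<Otimes>\<^sub>M M)"
      by measurable
    then have g: "case_prod ?g \<in> borel_measurable (M \<Otimes>\<^sub>M M)"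
      by (simp add: case_prod_beta' indicator_def)
    have "(\<lambda>x. 1 / emeasure M (ball x t)) \<in> borel_measurable M"
      by measurable
    then have m: "(\<lambda>x. 1 / emeasure M (ball x t) * (\<integral>\<^sup>+y. ?g x y \<partial>M)) \<in> borel_measurable M"
      by (intro borel_measurable_times_ennreal borel_measurable_nn_integral g)
    have "(\<integral>\<^sup>+x. 1 / emeasure M (ball x t) * (\<integral>\<^sup>+y. ?g x y \<partial>M) \<partial>M) = 0"
      using zero[OF t] unfolding scale_energy_def .
    then have "AE x in M. 1 / emeasure M (ball x t) * (\<integral>\<^sup>+y. ?g x y \<partial>M) = 0"
      by (rule iffD1[OF nn_integral_0_iff_AE[OF m]])
    then show ?thesis
    proof eventually_elim
      case (elim x)
      \<comment> \<open>The reciprocal would be 0 for a ball of infinite volume; finiteness of balls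
        excludes this.\<close>
      moreover have "1 / emeasure M (ball x t) \<noteq> 0"
        using ball_finite[OF t, of x] by (simp add: divide_ennreal_def)
      ultimately have "(\<integral>\<^sup>+y. ?g x y \<partial>M) = 0"
        by simp
      moreover have "?g x \<in> borel_measurable M"
        by measurable
      ultimately have "AE y in M. ?g x y = 0"
        by (simp only: nn_integral_0_iff_AE)
      then show ?case
      proof eventually_elim
        case (elim y)
        show ?case
        proof
          assume "y \<in> ball x t"
          with elim have "\<bar>u y - u x\<bar> powr p / t powr (s * p) = 0"
            by (intro antisym) (simp_all add: ennreal_eq_0_iff)
          with t show "u y = u x"
            by simp
        qed
      qed
    qed
  qed
  have all: "AE x in M. \<forall>n::nat. AE y in M. y \<in> ball x (Suc n) \<longrightarrow> u y = u x"
    unfolding AE_all_countable using ae by simp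
  \<comment> \<open>An almost everywhere property yields an actual point only if the measure is not
    zero.\<close>
  have "emeasure M (space M) \<noteq> 0"
    using ball_pos[of 1 undefined] emeasure_mono[of "ball undefined 1" "space M" M]
    by (auto simp: not_le[symmetric])
  then have nontrivial: "\<not> (AE x in M. False)"
    by (simp add: AE_iff_null null_sets_def)
  have "\<exists>x. \<forall>n::nat. AE y in M. y \<in> ball x (Suc n) \<longrightarrow> u y = u x"
  proof (rule ccontr)
    assume none: "\<nexists>x. \<forall>n::nat. AE y in M. y \<in> ball x (Suc n) \<longrightarrow> u y = u x"
    from all have "AE x in M. False"
      by (rule eventually_mono) (use none in blast)
    with nontrivial show False ..
  qed
  then obtain x where "\<forall>n::nat. AE y in M. y \<in> ball x (Suc n) \<longrightarrow> u y = u x" ..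
  then have "AE y in M. \<forall>n::nat. y \<in> ball x (Suc n) \<longrightarrow> u y = u x"
    by (rule iffD2[OF AE_all_countable])
  then have "AE y in M. u y = u x"
  proof eventually_elim
    case (elim y)
    obtain n :: nat where "dist x y < n" using reals_Archimedean2 by blast
    then have "y \<in> ball x (Suc n)" by simp
    with elim show ?case by blast
  qed
  then show ?thesis unfolding ae_constant_def by blast
qed

text \<open>The exponent \<open>r\<close> of weak maximality is kept apart from the exponent
  \<open>s\<close> of the space, so that \<open>s = r\<close> gives the dimension bound and larger
  \<open>s\<close> the bound on the critical exponent.\<close>

lemma besov_pp_ae_constant:
  assumes "doubling M" "weak_maximality M p r" "0 < p" "0 < r" "r \<le> s" "u \<in> besov_pp M p s"
  shows "ae_constant M u"
proof -
  have inf: "u \<in> besov_inf M p r"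
    using besov_pp_subset_besov_inf assms by blast
  then have meas: "u \<in> borel_measurable M" and fin: "besov_inf_energy M p r u < \<infinity>"
    by (auto simp: besov_inf_def Lp_space_def)
  have "KS_norm M p r u = 0"
    using assms by (simp add: KS_norm_def besov_pp_imp_KS_zero ennreal_powr_def)
  then have "besov_inf_norm M p r u = 0"
    using assms(2) inf unfolding weak_maximality_def by force
  \<comment> \<open>\<open>enn2real\<close> sends infinity to 0 as well, a case that
    \<open>fin\<close> excludes.\<close>
  then have "besov_inf_energy M p r u = 0"
    using fin by (simp add: besov_inf_norm_def ennreal_powr_def enn2real_eq_0_iff split: if_splits)
  then have "scale_energy M p r u t = 0" if "0 < t" for t
    using that unfolding besov_inf_energy_def
    by (metis SUP_upper greaterThan_iff le_zero_eq)
  then show ?thesis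
    by (rule ae_constant_if_scale_energy_zero[OF meas])
qed

end

section \<open>Linear dependence modulo null sets\<close>

lemma ae_dim_le_1:
  assumes "\<And>u. u \<in> V \<Longrightarrow> ae_constant M u"
  shows "ae_dim M V \<le> 1"
  unfolding ae_dim_def
proof (rule SUP_least)
  fix S assume "S \<in> {S. finite S \<and> S \<subseteq> V \<and> ae_independent M S}"
  then have S: "finite S" "S \<subseteq> V" "ae_independent M S" by auto
  have "u = v" if uv: "u \<in> S" "v \<in> S" for u v
  proof (rule ccontr)
    assume ne: "u \<noteq> v"
    obtain a b where ab: "AE x in M. u x = a" "AE x in M. v x = b"
      using assms uv S unfolding ae_constant_def by (meson subsetD)
    \<comment> \<open>The relation is b u - a v = 0. For a = 0 it could be trivial, so u = 0 is used
      instead; in both cases one coefficient is nonzero. Setting \<open>c\<close> to 0 elsewhere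
      extends the relation to all of \<open>S\<close>.\<close>
    define \<alpha> \<beta> :: real where "\<alpha> = (if a = 0 then 1 else b)" and "\<beta> = (if a = 0 then 0 else - a)"
    define c where "c = (\<lambda>w. if w = u then \<alpha> else if w = v then \<beta> else 0)"
    have "(\<Sum>w\<in>S. c w * w x) = \<alpha> * u x + \<beta> * v x" for x
    proof -
      have "(\<Sum>w\<in>S. c w * w x) = (\<Sum>w\<in>{u, v}. c w * w x)"
        using S uv by (intro sum.mono_neutral_right) (auto simp: c_def)
      then show ?thesis using ne by (simp add: c_def)
    qed
    moreover have "AE x in M. \<alpha> * u x + \<beta> * v x = 0"
      using ab by eventually_elim (auto simp: \<alpha>_def \<beta>_def)
    ultimately have "\<forall>w\<in>S. c w = 0"
      using S(3) unfolding ae_independent_def by simp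
    with uv ne have "\<alpha> = 0" "\<beta> = 0" by (auto simp: c_def)
    then show False by (auto simp: \<alpha>_def \<beta>_def split: if_splits)
  qed
  then have "card S \<le> 1"
    using S(1) by (auto simp: card_le_Suc0_iff_eq)
  then show "enat (card S) \<le> 1"
    by (simp add: one_enat_def)
qed

theorem theorem1p5:
  fixes M :: "'a::{metric_space, second_countable_topology} measure" and p \<theta> :: real
  assumes "infinite (UNIV :: 'a set)"
    and "sets M = sets borel"
    and "\<And>x r. 0 < r \<Longrightarrow> 0 < emeasure M (ball x r) \<and> emeasure M (ball x r) < \<infinity>"
    and "doubling M"
    and "1 < p" and "0 < \<theta>"
    and "weak_maximality M p \<theta>"
  shows "ae_dim M (besov_pp M p \<theta>) \<le> 1 \<and> critical_exponent M p \<le> ennreal \<theta>"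
proof -
  interpret ball_finite_measure M
    using assms(2,3) by unfold_locales auto
  have const: "ae_constant M u" if "\<theta> \<le> s" "u \<in> besov_pp M p s" for s u
    using assms that by (intro besov_pp_ae_constant[of p \<theta> s]) auto
  have "critical_exponent M p \<le> ennreal \<theta>"
    unfolding critical_exponent_def
  proof (rule Sup_least, safe)
    fix s u assume "0 < s" "u \<in> besov_pp M p s" "\<not> ae_constant M u"
    then show "ennreal s \<le> ennreal \<theta>"
      \<comment> \<open>A function that is not constant almost everywhere rules out
        \<open>\<theta> \<le> s\<close>.\<close>
      using const[of s u] by (intro ennreal_leI) linarith
  qed
  then show ?thesis
    using const[OF order_refl] ae_dim_le_1 by blast
qed

end
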